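(* Let $p,q,r,s,f,g:[t_0,+\infty)\to\mathbb{R}$ be continuous functions. Consider the nonhomogeneous linear system $$\phi' = p(t)\phi + q(t)\psi + f(t),\qquad \psi' = r(t)\phi + s(t)\psi + g(t),\qquad t\ge t_0, \tag{N}$$ and the corresponding homogeneous system $$\phi' = p(t)\phi + q(t)\psi,\qquad \psi' = r(t)\phi + s(t)\psi,\qquad t\ge t_0. \tag{H}$$ For $\lambda\in\mathbb{R}$ put $$\alpha_\lambda(t) = \exp\left\{\int_{t_0}^{t}p(\tau)\,d\tau\right\}\left[\lambda + \int_{t_0}^{t}\exp\left\{-\int_{t_0}^{\tau}p(\sigma)\,d\sigma\right\}f(\tau)\,d\tau\right],\qquad t\ge t_0.$$ Suppose that: (1) $q(t)\ge 0$ for all $t\ge t_0$; (2) there exists $\lambda\ge 0$ such that $\alpha_\lambda(t)\ge 0$ for all $t\ge t_0$ and $r(t)\alpha_\lambda(t)+g(t)\ge 0$ for all $t\ge t_0$. If the homogeneous system (H) is non oscillatory, then the nonhomogeneous system (N) is also non oscillatory.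
   Context: All functions and solutions are real-valued; solutions $(\phi(t),\psi(t))$ of the linear systems are defined on $[t_0,+\infty)$. A linear system of the form $\phi' = p(t)\phi + q(t)\psi + f(t)$, $\psi' = r(t)\phi + s(t)\psi + g(t)$, $t\ge t_0$, with continuous real-valued coefficients $p,q,r,s,f,g$ on $[t_0,+\infty)$ (nonhomogeneous, or homogeneous in the case $f\equiv g\equiv 0$) is called oscillatory if for each of its solutions $(\phi(t),\psi(t))$ the function $\phi(t)$ has arbitrarily large zeroes; otherwise it is called non oscillatory. *)

theory Defs
  imports "HOL-Analysis.Analysis"
begin

text \<open>
  Functions on \<open>[t0, \<infinity>)\<close> are total functions of type \<open>real \<Rightarrow> real\<close> of which only the values
  on \<open>{t0..}\<close> matter; the derivative at the end point \<open>t0\<close> is the one-sided one.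
\<close>

definition linear_system_solution ::
  "real \<Rightarrow> (real \<Rightarrow> real) \<Rightarrow> (real \<Rightarrow> real) \<Rightarrow> (real \<Rightarrow> real) \<Rightarrow> (real \<Rightarrow> real) \<Rightarrow>
   (real \<Rightarrow> real) \<Rightarrow> (real \<Rightarrow> real) \<Rightarrow> (real \<Rightarrow> real) \<Rightarrow> (real \<Rightarrow> real) \<Rightarrow> bool"
where
  "linear_system_solution t0 p q r s f g \<phi> \<psi> \<longleftrightarrow>
    (\<forall>t\<ge>t0.
      (\<phi> has_real_derivative (p t * \<phi> t + q t * \<psi> t + f t)) (at t within {t0..}) \<and>
      (\<psi> has_real_derivative (r t * \<phi> t + s t * \<psi> t + g t)) (at t within {t0..}))"

definition has_arbitrarily_large_zeroes :: "real \<Rightarrow> (real \<Rightarrow> real) \<Rightarrow> bool" where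
  "has_arbitrarily_large_zeroes t0 \<phi> \<longleftrightarrow> (\<forall>T. \<exists>t\<ge>t0. t \<ge> T \<and> \<phi> t = 0)"

text \<open>
  All solutions are quantified over. In the homogeneous case this includes the trivial one,
  which satisfies the condition anyway.
\<close>

definition oscillatory ::
  "real \<Rightarrow> (real \<Rightarrow> real) \<Rightarrow> (real \<Rightarrow> real) \<Rightarrow> (real \<Rightarrow> real) \<Rightarrow> (real \<Rightarrow> real) \<Rightarrow>
   (real \<Rightarrow> real) \<Rightarrow> (real \<Rightarrow> real) \<Rightarrow> bool"
where
  "oscillatory t0 p q r s f g \<longleftrightarrow>
    (\<forall>\<phi> \<psi>. linear_system_solution t0 p q r s f g \<phi> \<psi> \<longrightarrow> has_arbitrarily_large_zeroes t0 \<phi>)"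

definition alpha_fun :: "real \<Rightarrow> (real \<Rightarrow> real) \<Rightarrow> (real \<Rightarrow> real) \<Rightarrow> real \<Rightarrow> real \<Rightarrow> real" where
  "alpha_fun t0 p f l t =
    exp (integral {t0..t} p) *
    (l + integral {t0..t} (\<lambda>\<tau>. exp (- integral {t0..\<tau>} p) * f \<tau>))"

end

theory Submission
  imports Defs
begin

text \<open>
  Subtracting \<open>\<alpha>\<^sub>\<lambda>\<close> from \<open>\<phi>\<close> turns (N) into the same system with \<open>f = 0\<close> and \<open>g\<close> replaced by
  \<open>h = r \<alpha>\<^sub>\<lambda> + g \<ge> 0\<close>. Let \<open>(\<phi>\<^sub>0, \<psi>\<^sub>0)\<close> solve (H) with \<open>\<phi>\<^sub>0 > 0\<close> on \<open>[T, \<infinity>)\<close>, and let \<open>(\<phi>, \<psi>)\<close> be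
  the solution of (N) for which \<open>(u, \<psi>)\<close>, with \<open>u = \<phi> - \<alpha>\<^sub>\<lambda>\<close>, agrees with \<open>(\<phi>\<^sub>0, \<psi>\<^sub>0)\<close> at \<open>T\<close>.
  The Wronskian \<open>W = \<phi>\<^sub>0 \<psi> - \<psi>\<^sub>0 u\<close> satisfies \<open>W' = (p + s) W + \<phi>\<^sub>0 h\<close> and vanishes at \<open>T\<close>, hence is
  nonnegative from \<open>T\<close> on. Since \<open>(u / \<phi>\<^sub>0)' = q W / \<phi>\<^sub>0\<^sup>2 \<ge> 0\<close>, we get \<open>u \<ge> \<phi>\<^sub>0 > 0\<close>, so \<open>\<phi> > 0\<close>.

  The solution of (N) is obtained by quadratures from the solution \<open>x\<^sub>0 = (\<phi>\<^sub>0, \<psi>\<^sub>0)\<close> of (H), which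
  vanishes nowhere: in the frame \<open>x\<^sub>0, J x\<^sub>0\<close>, with \<open>J\<close> the rotation by a right angle, (N) becomes
  triangular.
\<close>

section \<open>Calculus on a half-line and scalar linear equations\<close>

lemma integral_has_real_derivative_atLeast:
  fixes f :: "real \<Rightarrow> real"
  assumes "continuous_on {t0..} f" and "t0 \<le> t"
  shows "((\<lambda>t. integral {t0..t} f) has_real_derivative f t) (at t within {t0..})"
proof -
  have "continuous_on {t0..t + 1} f"
    using assms(1) by (rule continuous_on_subset) auto
  then have "((\<lambda>t. integral {t0..t} f) has_real_derivative f t) (at t within {t0..t + 1})"
    using assms(2) by (intro integral_has_real_derivative) auto
  moreover have "at t within {t0..t + 1} = at t within {t0..}"
    by (rule at_within_nhd[of _ "{..<t + 1}"]) auto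
  ultimately show ?thesis by simp
qed

lemma nondecreasing_if_nonneg_derivative_atLeast:
  fixes F F' :: "real \<Rightarrow> real"
  assumes deriv: "\<And>t. t0 \<le> t \<Longrightarrow> (F has_real_derivative F' t) (at t within {t0..})"
    and nonneg: "\<And>t. T \<le> t \<Longrightarrow> 0 \<le> F' t"
    and le: "t0 \<le> T" "T \<le> t"
  shows "F T \<le> F t"
proof -
  have "(F has_derivative (*) (F' x)) (at x within {T..t})" if "x \<in> {T..t}" for x
    using deriv[of x] that le
    by (auto simp: has_field_derivative_def intro: has_derivative_subset)
  then obtain x where "x \<in> {T..t}" "F t - F T = F' x * (t - T)"
    using mvt_very_simple[OF le(2), of F "\<lambda>x. (*) (F' x)"] by auto
  then show ?thesis
    using nonneg[of x] le by (smt (verit) atLeastAtMost_iff mult_nonneg_nonneg)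
qed

text \<open>Variation of constants. For \<open>P = p\<close>, \<open>R = f\<close>,
  \<open>c = l\<close> the function is \<open>alpha_fun t0 p f l\<close>, so \<alpha> solves the
  first equation of (N) with the \<open>q\<close> term dropped.\<close>

lemma scalar_linear_solution:
  fixes P R :: "real \<Rightarrow> real"
  assumes P: "continuous_on {t0..} P" and R: "continuous_on {t0..} R" and t: "t0 \<le> t"
  shows "((\<lambda>t. exp (integral {t0..t} P) *
           (c + integral {t0..t} (\<lambda>\<tau>. exp (- integral {t0..\<tau>} P) * R \<tau>)))
         has_real_derivative
         P t * (exp (integral {t0..t} P) *
           (c + integral {t0..t} (\<lambda>\<tau>. exp (- integral {t0..\<tau>} P) * R \<tau>))) + R t)
         (at t within {t0..})"
proof -
  note dP = integral_has_real_derivative_atLeast[OF P]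
  have "continuous_on {t0..} (\<lambda>t. integral {t0..t} P)"
    using dP by (intro DERIV_continuous_on) auto
  then have "continuous_on {t0..} (\<lambda>\<tau>. exp (- integral {t0..\<tau>} P) * R \<tau>)"
    using R by (intro continuous_intros)
  note dI = integral_has_real_derivative_atLeast[OF this t]
  show ?thesis
    by (rule derivative_eq_intros dP[OF t] dI refl)+
      (simp add: algebra_simps exp_minus)
qed

lemma scalar_linear_solution_exists:
  fixes P R :: "real \<Rightarrow> real"
  assumes "continuous_on {t0..} P" and "continuous_on {t0..} R"
  obtains w where "w T = c"
    "\<And>t. t0 \<le> t \<Longrightarrow> (w has_real_derivative P t * w t + R t) (at t within {t0..})"
proof -
  let ?I = "\<lambda>t. integral {t0..t} (\<lambda>\<tau>. exp (- integral {t0..\<tau>} P) * R \<tau>)"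
  \<comment> \<open>The constant is chosen so that at \<open>T\<close> the bracket collapses to
    \<open>c * exp (- integral {t0..T} P)\<close>.\<close>
  let ?w = "\<lambda>t. exp (integral {t0..t} P) * (c * exp (- integral {t0..T} P) - ?I T + ?I t)"
  show thesis
  proof (rule that[of ?w])
    show "?w T = c" by (simp add: exp_minus)
    show "(?w has_real_derivative P t * ?w t + R t) (at t within {t0..})" if "t0 \<le> t" for t
      by (rule scalar_linear_solution[OF assms that])
  qed
qed

section \<open>Planar linear systems: nonvanishing and existence of solutions\<close>

lemma linear_system_solutionD:
  assumes "linear_system_solution t0 p q r s f g \<phi> \<psi>" and "t0 \<le> t"
  shows "(\<phi> has_real_derivative p t * \<phi> t + q t * \<psi> t + f t) (at t within {t0..})"
    and "(\<psi> has_real_derivative r t * \<phi> t + s t * \<psi> t + g t) (at t within {t0..})"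
  using assms by (auto simp: linear_system_solution_def)

lemma linear_system_solution_continuous_on:
  assumes "linear_system_solution t0 p q r s f g \<phi> \<psi>"
  shows "continuous_on {t0..} \<phi>" and "continuous_on {t0..} \<psi>"
  using linear_system_solutionD[OF assms] by (auto intro!: DERIV_continuous_on)

text \<open>A Gronwall argument: the squared norm \<open>N\<close> has derivative \<open>D\<close>,
  and \<open>D \<le> K * N\<close>. So \<open>N * E\<close> is nonincreasing, and a zero of
  \<open>N\<close> at \<open>t\<close> would force one at the later point \<open>T\<close>.\<close>

lemma homogeneous_solution_nonzero_before:
  assumes cont: "continuous_on {t0..} p" "continuous_on {t0..} q"
      "continuous_on {t0..} r" "continuous_on {t0..} s"
    and sol: "linear_system_solution t0 p q r s (\<lambda>_. 0) (\<lambda>_. 0) \<phi> \<psi>"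
    and T: "t0 \<le> t" "t \<le> T" "\<phi> T \<noteq> 0"
  shows "(\<phi> t)\<^sup>2 + (\<psi> t)\<^sup>2 \<noteq> 0"
proof
  assume zero: "(\<phi> t)\<^sup>2 + (\<psi> t)\<^sup>2 = 0"
  define K where "K t = 2 * \<bar>p t\<bar> + \<bar>q t\<bar> + \<bar>r t\<bar> + 2 * \<bar>s t\<bar>" for t
  define E where "E t = exp (- integral {t0..t} K)" for t
  define N where "N t = (\<phi> t)\<^sup>2 + (\<psi> t)\<^sup>2" for t
  define D where "D t = 2 * (p t * (\<phi> t)\<^sup>2 + (q t + r t) * (\<phi> t * \<psi> t) + s t * (\<psi> t)\<^sup>2)" for t
  have "continuous_on {t0..} K"
    unfolding K_def using cont by (intro continuous_intros)
  note dK = integral_has_real_derivative_atLeast[OF this]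
  have "((\<lambda>t. - (N t * E t)) has_real_derivative E t * (K t * N t - D t)) (at t within {t0..})"
    if "t0 \<le> t" for t
    unfolding N_def E_def
    by (rule derivative_eq_intros dK that linear_system_solutionD[OF sol that] refl)+
      (simp add: D_def algebra_simps power2_eq_square)
  moreover have "0 \<le> E t * (K t * N t - D t)" for t
  proof -
    have xy: "2 * \<bar>\<phi> t * \<psi> t\<bar> \<le> N t"
      using sum_squares_bound[of "\<bar>\<phi> t\<bar>" "\<bar>\<psi> t\<bar>"] by (simp add: N_def abs_mult)
    have "p t * (\<phi> t)\<^sup>2 \<le> \<bar>p t\<bar> * N t" "s t * (\<psi> t)\<^sup>2 \<le> \<bar>s t\<bar> * N t"
      by (auto simp: N_def intro!: mult_mono)
    moreover have "2 * ((q t + r t) * (\<phi> t * \<psi> t)) \<le> (\<bar>q t\<bar> + \<bar>r t\<bar>) * N t"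
    proof -
      have "2 * ((q t + r t) * (\<phi> t * \<psi> t)) \<le> \<bar>q t + r t\<bar> * (2 * \<bar>\<phi> t * \<psi> t\<bar>)"
        using abs_ge_self[of "2 * ((q t + r t) * (\<phi> t * \<psi> t))"] by (simp add: abs_mult)
      also have "\<dots> \<le> (\<bar>q t\<bar> + \<bar>r t\<bar>) * N t"
        using xy by (intro mult_mono) auto
      finally show ?thesis .
    qed
    ultimately have "D t \<le> K t * N t"
      unfolding D_def K_def by (simp add: algebra_simps)
    then show ?thesis by (simp add: E_def)
  qed
  ultimately have "- (N t * E t) \<le> - (N T * E T)"
    by (rule nondecreasing_if_nonneg_derivative_atLeast) (use T in auto)
  moreover have "0 < N T * E T"
    using T(3) by (simp add: N_def E_def sum_power2_gt_zero_iff)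
  moreover have "N t = 0" using zero by (simp add: N_def)
  ultimately show False by simp
qed

text \<open>The solution is sought as \<open>a\<close> times \<open>(\<phi>0, \<psi>0)\<close> plus
  \<open>b\<close> times \<open>(- \<psi>0, \<phi>0)\<close>. Its Wronskian with
  \<open>(\<phi>0, \<psi>0)\<close> is \<open>W = b * N\<close>, which obeys a scalar linear
  equation; once \<open>b\<close> is known, \<open>a\<close> is an antiderivative.\<close>

lemma linear_system_solution_exists:
  assumes cont: "continuous_on {t0..} p" "continuous_on {t0..} q"
      "continuous_on {t0..} r" "continuous_on {t0..} s"
      "continuous_on {t0..} f" "continuous_on {t0..} g"
    and sol: "linear_system_solution t0 p q r s (\<lambda>_. 0) (\<lambda>_. 0) \<phi>0 \<psi>0"
    and nz: "\<And>t. t0 \<le> t \<Longrightarrow> (\<phi>0 t)\<^sup>2 + (\<psi>0 t)\<^sup>2 \<noteq> 0"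
    and T: "t0 \<le> T"
  obtains \<phi> \<psi> where "linear_system_solution t0 p q r s f g \<phi> \<psi>" "\<phi> T = x" "\<psi> T = y"
proof -
  define N where "N t = (\<phi>0 t)\<^sup>2 + (\<psi>0 t)\<^sup>2" for t
  have N0: "N t \<noteq> 0" if "t0 \<le> t" for t
    using nz[OF that] by (simp add: N_def)
  note cont0 = linear_system_solution_continuous_on[OF sol]
  have contN: "continuous_on {t0..} N"
    unfolding N_def by (intro continuous_intros cont0)
  obtain W where WT: "W T = \<phi>0 T * y - \<psi>0 T * x" and dW: "\<And>t. t0 \<le> t \<Longrightarrow>
      (W has_real_derivative (p t + s t) * W t + (\<phi>0 t * g t - \<psi>0 t * f t)) (at t within {t0..})"
    by (rule scalar_linear_solution_exists[of t0 "\<lambda>t. p t + s t"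
          "\<lambda>t. \<phi>0 t * g t - \<psi>0 t * f t" T])
      (use cont cont0 in \<open>auto intro!: continuous_intros\<close>)
  have contW: "continuous_on {t0..} W"
    using dW by (intro DERIV_continuous_on) auto
  define b where "b t = W t / N t" for t
  \<comment> \<open>Inner product of the system with \<open>(\<phi>0, \<psi>0)\<close>, divided by
    \<open>N\<close>. The coefficient \<open>a\<close> drops out because
    \<open>(\<phi>0, \<psi>0)\<close> solves (H); the bracket after \<open>b t\<close> comes from
    the commutator of the coefficient matrix with the rotation.\<close>
  define a' where "a' t = (b t * ((q t + r t) * ((\<phi>0 t)\<^sup>2 - (\<psi>0 t)\<^sup>2)
    + 2 * (s t - p t) * (\<phi>0 t * \<psi>0 t)) + (f t * \<phi>0 t + g t * \<psi>0 t)) / N t" for t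
  have "continuous_on {t0..} a'"
    unfolding a'_def b_def
    by (intro continuous_intros cont cont0 contN contW) (use N0 in auto)
  then obtain a where aT: "a T = (\<phi>0 T * x + \<psi>0 T * y) / N T"
    and da: "\<And>t. t0 \<le> t \<Longrightarrow> (a has_real_derivative a' t) (at t within {t0..})"
    using scalar_linear_solution_exists[of t0 "\<lambda>_. 0" a' T "(\<phi>0 T * x + \<psi>0 T * y) / N T"]
    by auto
  \<comment> \<open>The quotient rule for \<open>W / N\<close>, with \<open>b\<close> written for
    \<open>W / N\<close> in the second term.\<close>
  define b' where "b' t = ((p t + s t) * W t + (\<phi>0 t * g t - \<psi>0 t * f t)
    - b t * (2 * (p t * (\<phi>0 t)\<^sup>2 + (q t + r t) * (\<phi>0 t * \<psi>0 t) + s t * (\<psi>0 t)\<^sup>2))) / N t" for t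
  have db: "(b has_real_derivative b' t) (at t within {t0..})" if "t0 \<le> t" for t
  proof -
    have "(N has_real_derivative
        2 * (p t * (\<phi>0 t)\<^sup>2 + (q t + r t) * (\<phi>0 t * \<psi>0 t) + s t * (\<psi>0 t)\<^sup>2)) (at t within {t0..})"
      unfolding N_def
      by (rule derivative_eq_intros linear_system_solutionD[OF sol that] refl)+
        (simp add: algebra_simps power2_eq_square)
    from DERIV_divide[OF dW[OF that] this N0[OF that]] show ?thesis
      unfolding b_def[abs_def] b'_def
      by (rule DERIV_cong) (use N0[OF that] in \<open>simp add: field_simps\<close>)
  qed
  show ?thesis
  proof (rule that)
    show "a T * \<phi>0 T - b T * \<psi>0 T = x" "a T * \<psi>0 T + b T * \<phi>0 T = y"
    proof -
      \<comment> \<open>The initial values of \<open>a\<close> and \<open>b\<close> are the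
        coordinates of \<open>(x, y)\<close> in the orthogonal frame at \<open>T\<close>.\<close>
      have "a T * N T = \<phi>0 T * x + \<psi>0 T * y" "b T * N T = \<phi>0 T * y - \<psi>0 T * x"
        using N0[OF T] by (simp_all add: aT b_def WT)
      then have "N T * (a T * \<phi>0 T - b T * \<psi>0 T) = N T * x"
        "N T * (a T * \<psi>0 T + b T * \<phi>0 T) = N T * y"
        unfolding N_def by algebra+
      then show "a T * \<phi>0 T - b T * \<psi>0 T = x" "a T * \<psi>0 T + b T * \<phi>0 T = y"
        using N0[OF T] by auto
    qed
    have "((\<lambda>t. a t * \<phi>0 t - b t * \<psi>0 t) has_real_derivative
        p t * (a t * \<phi>0 t - b t * \<psi>0 t) + q t * (a t * \<psi>0 t + b t * \<phi>0 t) + f t)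
        (at t within {t0..})" (is "(_ has_real_derivative ?F) _")
      and "((\<lambda>t. a t * \<psi>0 t + b t * \<phi>0 t) has_real_derivative
        r t * (a t * \<phi>0 t - b t * \<psi>0 t) + s t * (a t * \<psi>0 t + b t * \<phi>0 t) + g t)
        (at t within {t0..})" (is "(_ has_real_derivative ?G) _")
      if "t0 \<le> t" for t
    proof -
      have eqs: "b t * N t = W t"
        "a' t * N t = b t * ((q t + r t) * ((\<phi>0 t)\<^sup>2 - (\<psi>0 t)\<^sup>2)
          + 2 * (s t - p t) * (\<phi>0 t * \<psi>0 t)) + (f t * \<phi>0 t + g t * \<psi>0 t)"
        "b' t * N t = (p t + s t) * W t + (\<phi>0 t * g t - \<psi>0 t * f t)
          - b t * (2 * (p t * (\<phi>0 t)\<^sup>2 + (q t + r t) * (\<phi>0 t * \<psi>0 t) + s t * (\<psi>0 t)\<^sup>2))"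
        using N0[OF that] by (simp_all add: b_def a'_def b'_def)
      let ?x = "p t * \<phi>0 t + q t * \<psi>0 t" and ?y = "r t * \<phi>0 t + s t * \<psi>0 t"
      \<comment> \<open>Multiplying by \<open>N t\<close> clears the denominators of
        \<open>a'\<close> and \<open>b'\<close>; once \<open>W\<close> is replaced by
        \<open>b * N\<close>, a polynomial identity remains.\<close>
      have "N t * (a' t * \<phi>0 t + a t * ?x - (b' t * \<psi>0 t + b t * ?y)) =
          (a' t * N t) * \<phi>0 t - (b' t * N t) * \<psi>0 t + N t * (a t * ?x - b t * ?y)"
        by (simp add: algebra_simps)
      also have "\<dots> = N t * ?F"
        unfolding eqs(2,3) unfolding eqs(1)[symmetric] N_def
        by (simp add: algebra_simps power2_eq_square)
      finally have "N t * (a' t * \<phi>0 t + a t * ?x - (b' t * \<psi>0 t + b t * ?y)) = N t * ?F" .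
      then have F: "a' t * \<phi>0 t + a t * ?x - (b' t * \<psi>0 t + b t * ?y) = ?F"
        using N0[OF that] by simp
      have "N t * (a' t * \<psi>0 t + a t * ?y + (b' t * \<phi>0 t + b t * ?x)) =
          (a' t * N t) * \<psi>0 t + (b' t * N t) * \<phi>0 t + N t * (a t * ?y + b t * ?x)"
        by (simp add: algebra_simps)
      also have "\<dots> = N t * ?G"
        unfolding eqs(2,3) unfolding eqs(1)[symmetric] N_def
        by (simp add: algebra_simps power2_eq_square)
      finally have "N t * (a' t * \<psi>0 t + a t * ?y + (b' t * \<phi>0 t + b t * ?x)) = N t * ?G" .
      then have G: "a' t * \<psi>0 t + a t * ?y + (b' t * \<phi>0 t + b t * ?x) = ?G"
        using N0[OF that] by simp
      note ds = da[OF that] db[OF that] linear_system_solutionD[OF sol that]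
      show "((\<lambda>t. a t * \<phi>0 t - b t * \<psi>0 t) has_real_derivative ?F) (at t within {t0..})"
        unfolding F[symmetric]
        by (rule derivative_eq_intros ds refl)+ (simp add: algebra_simps)
      show "((\<lambda>t. a t * \<psi>0 t + b t * \<phi>0 t) has_real_derivative ?G) (at t within {t0..})"
        unfolding G[symmetric]
        by (rule derivative_eq_intros ds refl)+ (simp add: algebra_simps)
    qed
    then show "linear_system_solution t0 p q r s f g
        (\<lambda>t. a t * \<phi>0 t - b t * \<psi>0 t) (\<lambda>t. a t * \<psi>0 t + b t * \<phi>0 t)"
      by (simp add: linear_system_solution_def)
  qed
qed

section \<open>Positive solutions and the comparison\<close>

text \<open>By the intermediate value theorem a solution without zeroes from \<open>T\<close> on
  keeps its sign there; if that sign is negative, the negated solution serves, as (H) is linear and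
  homogeneous.\<close>

lemma eventually_positive_homogeneous_solution:
  assumes "\<not> oscillatory t0 p q r s (\<lambda>_. 0) (\<lambda>_. 0)"
  obtains \<phi> \<psi> T where "linear_system_solution t0 p q r s (\<lambda>_. 0) (\<lambda>_. 0) \<phi> \<psi>"
    "t0 \<le> T" "\<And>t. T \<le> t \<Longrightarrow> 0 < \<phi> t"
proof -
  obtain \<phi> \<psi> T0 where sol: "linear_system_solution t0 p q r s (\<lambda>_. 0) (\<lambda>_. 0) \<phi> \<psi>"
    and T0: "\<And>t. \<lbrakk>t0 \<le> t; T0 \<le> t\<rbrakk> \<Longrightarrow> \<phi> t \<noteq> 0"
    using assms unfolding oscillatory_def has_arbitrarily_large_zeroes_def by blast
  define T where "T = max t0 T0"
  have T: "t0 \<le> T" and nz: "\<And>t. T \<le> t \<Longrightarrow> \<phi> t \<noteq> 0"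
    using T0 by (auto simp: T_def)
  have cont: "continuous_on {T..t} \<phi>" for t
    using linear_system_solution_continuous_on(1)[OF sol] T
    by (auto elim: continuous_on_subset)
  show ?thesis
  proof (cases "0 < \<phi> T")
    case True
    have "0 < \<phi> t" if "T \<le> t" for t
      using IVT2'[of \<phi> t 0 T] cont[of t] nz True that
      by (metis atLeastAtMost_iff less_eq_real_def linorder_not_le)
    with sol T show ?thesis by (rule that)
  next
    case False
    have "0 < - \<phi> t" if "T \<le> t" for t
      using IVT'[of \<phi> T 0 t] cont[of t] nz False that
      by (smt (verit))
    moreover have "linear_system_solution t0 p q r s (\<lambda>_. 0) (\<lambda>_. 0) (\<lambda>t. - \<phi> t) (\<lambda>t. - \<psi> t)"
      unfolding linear_system_solution_def
    proof (intro allI impI conjI)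
      fix t assume t: "t0 \<le> t"
      show "((\<lambda>t. - \<phi> t) has_real_derivative p t * - \<phi> t + q t * - \<psi> t + 0) (at t within {t0..})"
        using DERIV_minus[OF linear_system_solutionD(1)[OF sol t]] by simp
      show "((\<lambda>t. - \<psi> t) has_real_derivative r t * - \<phi> t + s t * - \<psi> t + 0) (at t within {t0..})"
        using DERIV_minus[OF linear_system_solutionD(2)[OF sol t]] by simp
    qed
    ultimately show ?thesis using T that by blast
  qed
qed

theorem theorem3p1:
  fixes t0 :: real and p q r s f g :: "real \<Rightarrow> real"
  assumes "continuous_on {t0..} p" and "continuous_on {t0..} q"
    and "continuous_on {t0..} r" and "continuous_on {t0..} s"
    and "continuous_on {t0..} f" and "continuous_on {t0..} g"
    and "\<forall>t\<ge>t0. q t \<ge> 0"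
    and "\<exists>l\<ge>0. (\<forall>t\<ge>t0. alpha_fun t0 p f l t \<ge> 0) \<and>
                (\<forall>t\<ge>t0. r t * alpha_fun t0 p f l t + g t \<ge> 0)"
    and "\<not> oscillatory t0 p q r s (\<lambda>_. 0) (\<lambda>_. 0)"
  shows "\<not> oscillatory t0 p q r s f g"
proof -
  obtain l where \<alpha>: "\<And>t. t0 \<le> t \<Longrightarrow> 0 \<le> alpha_fun t0 p f l t"
    and h: "\<And>t. t0 \<le> t \<Longrightarrow> 0 \<le> r t * alpha_fun t0 p f l t + g t"
    using assms(8) by blast
  let ?\<alpha> = "alpha_fun t0 p f l"
  have d\<alpha>: "(?\<alpha> has_real_derivative p t * ?\<alpha> t + f t) (at t within {t0..})" if "t0 \<le> t" for t
    unfolding alpha_fun_def[abs_def] using scalar_linear_solution[OF assms(1,5) that] .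
  obtain \<phi>0 \<psi>0 T where sol0: "linear_system_solution t0 p q r s (\<lambda>_. 0) (\<lambda>_. 0) \<phi>0 \<psi>0"
    and T: "t0 \<le> T" and pos: "\<And>t. T \<le> t \<Longrightarrow> 0 < \<phi>0 t"
    using eventually_positive_homogeneous_solution[OF assms(9)] by blast
  \<comment> \<open>The point \<open>max t T\<close> is not before \<open>t\<close>, and
    \<open>\<phi>0\<close> is positive there.\<close>
  have nz: "(\<phi>0 t)\<^sup>2 + (\<psi>0 t)\<^sup>2 \<noteq> 0" if "t0 \<le> t" for t
    using homogeneous_solution_nonzero_before[OF assms(1-4) sol0 that, of "max t T"] pos[of "max t T"]
    by auto
  obtain \<phi> \<psi> where sol: "linear_system_solution t0 p q r s f g \<phi> \<psi>"
    and init: "\<phi> T = ?\<alpha> T + \<phi>0 T" "\<psi> T = \<psi>0 T"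
    using linear_system_solution_exists[OF assms(1-6) sol0 nz T] .
  define u where "u t = \<phi> t - ?\<alpha> t" for t
  have du: "(u has_real_derivative p t * u t + q t * \<psi> t) (at t within {t0..})" if "t0 \<le> t" for t
    unfolding u_def[abs_def]
    by (rule derivative_eq_intros d\<alpha> that linear_system_solutionD[OF sol that] refl)+
      (simp add: algebra_simps)
  define W where "W t = \<phi>0 t * \<psi> t - \<psi>0 t * u t" for t
  have dW: "(W has_real_derivative (p t + s t) * W t + \<phi>0 t * (r t * ?\<alpha> t + g t))
      (at t within {t0..})" if "t0 \<le> t" for t
    unfolding W_def[abs_def]
    by (rule derivative_eq_intros du[OF that] linear_system_solutionD[OF sol that]
          linear_system_solutionD[OF sol0 that] refl)+
      (simp add: u_def algebra_simps)
  have W: "0 \<le> W t" if "T \<le> t" for t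
  proof -
    \<comment> \<open>Integrating factor: it removes the term \<open>(p t + s t) * W t\<close>,
      leaving a derivative that is nonnegative from \<open>T\<close> on.\<close>
    define E where "E t = exp (- integral {t0..t} (\<lambda>t. p t + s t))" for t
    have "continuous_on {t0..} (\<lambda>t. p t + s t)"
      using assms by (intro continuous_intros)
    note dI = integral_has_real_derivative_atLeast[OF this]
    have "((\<lambda>t. W t * E t) has_real_derivative E t * (\<phi>0 t * (r t * ?\<alpha> t + g t)))
        (at t within {t0..})" if "t0 \<le> t" for t
      unfolding E_def
      by (rule derivative_eq_intros dW[OF that] dI[OF that] refl)+ (simp add: algebra_simps)
    moreover have "0 \<le> E t * (\<phi>0 t * (r t * ?\<alpha> t + g t))" if "T \<le> t" for t
      using that T h[of t] pos[of t] by (simp add: E_def)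
    ultimately have "W T * E T \<le> W t * E t"
      by (rule nondecreasing_if_nonneg_derivative_atLeast) (use T that in auto)
    moreover have "W T = 0" by (simp add: W_def u_def init)
    ultimately show ?thesis by (simp add: E_def zero_le_mult_iff)
  qed
  have "0 < \<phi> t" if t: "T \<le> t" for t
  proof -
    \<comment> \<open>The half-line starts at \<open>T\<close> here, since the quotient needs
      \<open>\<phi>0\<close> nonzero, which is known only from \<open>T\<close> on.\<close>
    have "((\<lambda>t. u t / \<phi>0 t) has_real_derivative q t * W t / (\<phi>0 t)\<^sup>2) (at t within {T..})"
      if "T \<le> t" for t
    proof -
      have "t0 \<le> t" "\<phi>0 t \<noteq> 0" using that T pos[of t] by auto
      have "((\<lambda>t. u t / \<phi>0 t) has_real_derivative q t * W t / (\<phi>0 t)\<^sup>2) (at t within {t0..})"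
        by (rule DERIV_cong[OF DERIV_divide[OF du[OF \<open>t0 \<le> t\<close>]
                linear_system_solutionD(1)[OF sol0 \<open>t0 \<le> t\<close>] \<open>\<phi>0 t \<noteq> 0\<close>]])
          (simp add: W_def power2_eq_square algebra_simps)
      then show ?thesis
        by (rule DERIV_subset) (use T in auto)
    qed
    moreover have "0 \<le> q t * W t / (\<phi>0 t)\<^sup>2" if "T \<le> t" for t
      using that T W[of t] assms(7) by auto
    ultimately have "u T / \<phi>0 T \<le> u t / \<phi>0 t"
      by (rule nondecreasing_if_nonneg_derivative_atLeast) (use t in auto)
    moreover have "u T / \<phi>0 T = 1"
      using pos[of T] by (simp add: u_def init)
    ultimately have "0 < u t"
      using pos[OF t] by (simp add: field_simps)
    \<comment> \<open>Here \<open>\<phi> = u + \<alpha>\<close> with \<open>u\<close> positive and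
      \<alpha> nonnegative.\<close>
    then show ?thesis
      using \<alpha>[of t] T t by (simp add: u_def)
  qed
  then have "\<not> has_arbitrarily_large_zeroes t0 \<phi>"
    unfolding has_arbitrarily_large_zeroes_def by (metis less_irrefl)
  with sol show ?thesis
    unfolding oscillatory_def by blast
qed

end
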